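(* Let $(\mathfrak g,\pi,D,\rho,\mu)$ be a pre-LieDer pair with representation space $V$. If two infinitesimal deformations $(\pi'_t=\pi+t\omega',\rho'_t=\rho+t\sigma',\mu'_t=\mu+t\tau',D'_t=D+t\hat D')$ and $(\pi_t=\pi+t\omega,\rho_t=\rho+t\sigma,\mu_t=\mu+t\tau,D_t=D+t\hat D)$ of it are equivalent, then $(\omega',\sigma',\tau',\hat D')$ and $(\omega,\sigma,\tau,\hat D)$ are in the same cohomology class of $H^2(\mathfrak g,\pi,\rho,\mu,D)$.
   Context: All vector spaces are over an algebraically closed field $\mathbb K$ of characteristic $0$. Pre-Lie algebra: a vector space $\mathfrak g$ with a bilinear product $\cdot$ (also denoted $\pi$) such that $(x\cdot y)\cdot z-x\cdot(y\cdot z)=(y\cdot x)\cdot z-y\cdot(x\cdot z)$. Its sub-adjacent Lie algebra $\mathfrak g^C$ has bracket $[x,y]_C=x\cdot y-y\cdot x$. A representation $(V;\rho,\mu)$ consists of a representation $\rho:\mathfrak g\to\mathfrak{gl}(V)$ of the Lie algebra $\mathfrak g^C$ and a linear map $\mu:\mathfrak g\to\mathfrak{gl}(V)$ with $\mu(y)\mu(x)-\mu(x\cdot y)=\mu(y)\rho(x)-\rho(x)\mu(y)$. A pre-LieDer pair $(\mathfrak g,\pi,D,\rho,\mu)$ is a pre-Lie algebra $(\mathfrak g,\pi)$ with a representation $(V;\rho,\mu)$ and a derivation, i.e. a linear map $D:\mathfrak g\to V$ with $D(x\cdot y)=\rho(x)D(y)+\mu(y)D(x)$. We write $\rho(x,v)=\rho(x)v$,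 $\mu(v,x)=\mu(x)v$, and similarly $\sigma(x,v)=\sigma(x)v$, $\tau(v,x)=\tau(x)v$. Infinitesimal deformation: linear maps $\omega:\mathfrak g\otimes\mathfrak g\to\mathfrak g$, $\sigma:\mathfrak g\otimes V\to V$, $\tau:V\otimes\mathfrak g\to V$, $\hat D:\mathfrak g\to V$ generate an infinitesimal deformation of $(\mathfrak g,\pi,D,\rho,\mu)$ if for all $t\in\mathbb K$, $(\mathfrak g,\pi_t=\pi+t\omega,D_t=D+t\hat D,\rho_t=\rho+t\sigma,\mu_t=\mu+t\tau)$ is a pre-LieDer pair. Equivalence: two infinitesimal deformations $(\pi'_t,\rho'_t,\mu'_t,D'_t)$ and $(\pi_t,\rho_t,\mu_t,D_t)$ are equivalent if there exist $N\in\mathfrak{gl}(\mathfrak g)$ and $S\in\mathfrak{gl}(V)$ such that (for all $t\in\mathbb K$) $(\mathrm{Id}_{\mathfrak g}+tN,\mathrm{Id}_V+tS)$ is a homomorphism from $(\mathfrak g,\pi'_t,D'_t,\rho'_t,\mu'_t)$ to $(\mathfrak g,\pi_t,D_t,\rho_t,\mu_t)$, i.e. for all $x,y\in\mathfrak g$: $(\mathrm{Id}+tN)\pi'_t(x,y)=\pi_t((\mathrm{Id}+tN)x,(\mathrm{Id}+tN)y)$; $(\mathrm{Id}_V+tS)\rho'_t(x)=\rho_t((\mathrm{Id}+tN)x)(\mathrm{Id}_V+tS)$; $(\mathrm{Id}_V+tS)\mu'_t(x)=\mu_t((\mathrm{Id}+tN)x)(\mathrm{Id}_V+tS)$; $(\mathrm{Id}_V+tS)D'_t=D_t(\mathrm{Id}+tN)$.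 Matsushima-Nijenhuis bracket: for a vector space $W$, $C^n(W;W)=\mathrm{Hom}(\wedge^{n-1}W\otimes W,W)$, $n\ge1$. For $P\in C^{p+1}(W;W)$, $Q\in C^{q+1}(W;W)$, $[P,Q]^{MN}=P\circ Q-(-1)^{pq}Q\circ P$, where $$(P\circ Q)(x_1,\dots,x_{p+q+1})=\sum_{\sigma\in\mathbb S_{(q,1,p-1)}}\mathrm{sgn}(\sigma)P(Q(x_{\sigma(1)},\dots,x_{\sigma(q+1)}),x_{\sigma(q+2)},\dots,x_{\sigma(p+q)},x_{p+q+1})$$ $$+(-1)^{pq}\sum_{\sigma\in\mathbb S_{(p,q)}}\mathrm{sgn}(\sigma)P(x_{\sigma(1)},\dots,x_{\sigma(p)},Q(x_{\sigma(p+1)},\dots,x_{\sigma(p+q)},x_{p+q+1})),$$ with $\mathbb S_{(i_1,\dots,i_k)}$ the unshuffles (first sum absent if $p=0$). It is used for $W=\mathfrak g\oplus V$, with the following maps regarded as elements of $C^*(W;W)$ via horizontal lifts: for $f$ in $\mathrm{Hom}(\wedge^{m-1}\mathfrak g\otimes\mathfrak g,\mathfrak g)$ or $\mathrm{Hom}(\wedge^{m-1}\mathfrak g\otimes\mathfrak g,V)$, $\hat f(x_1+v_1,\dots,x_m+v_m)=f(x_1,\dots,x_m)$; for $f\in\mathrm{Hom}(\wedge^{m-1}\mathfrak g\otimes V,V)$, $\hat f(\dots)=f(x_1,\dots,x_{m-1},v_m)$; for $f\in\mathrm{Hom}(\wedge^{m-2}\mathfrak g\otimes V\otimes\mathfrak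 g,V)$, $\hat f(\dots)=\sum_{i=1}^{m-1}(-1)^{m-1-i}f(x_1,\dots,\hat{x_i},\dots,x_{m-1},v_i,x_m)$. Cohomology: $C^0(\mathfrak g,\pi,\rho,\mu,D)=0$, $C^1(\mathfrak g,\pi,\rho,\mu,D)=\mathrm{Hom}(\mathfrak g,\mathfrak g)\oplus\mathrm{Hom}(V,V)$, and for $n\ge2$ $$C^n(\mathfrak g,\pi,\rho,\mu,D)=\mathrm{Hom}(\wedge^{n-1}\mathfrak g\otimes\mathfrak g,\mathfrak g)\oplus\mathrm{Hom}(\wedge^{n-1}\mathfrak g\otimes V,V)\oplus\mathrm{Hom}(\wedge^{n-2}\mathfrak g\otimes V\otimes\mathfrak g,V)\oplus\mathrm{Hom}(\wedge^{n-2}\mathfrak g\otimes\mathfrak g,V).$$ Write an $n$-cochain as $(f,\theta)$, $f$ in the first three summands and $\theta$ in the last ($f_\mu=0,\theta=0$ for $n=1$). The coboundary $\mathcal D:C^n\to C^{n+1}$ is $$\mathcal D(f,\theta)=(-1)^{n-2}\big(-[\pi+\rho+\mu,f]^{MN},\ [\pi+\rho+\mu,\theta]^{MN}+[f,D]^{MN}\big),$$ and $H^n(\mathfrak g,\pi,\rho,\mu,D)$ is the cohomology of this complex. *)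

theory Defs
  imports
    "HOL-Analysis.Product_Vector"
    "HOL-Library.Function_Algebras"
    "HOL-Combinatorics.Permutations"
    "HOL-Computational_Algebra.Polynomial"
begin

text \<open>
  A vector space is an abelian group type with an explicit scalar multiplication:
  \<open>sg\<close> on \<open>\<gg>\<close> (type \<open>'g\<close>) and \<open>sv\<close> on \<open>V\<close> (type \<open>'v\<close>).
  The dimensions may be infinite.
\<close>

section \<open>Pre-Lie algebras, representations and pre-LieDer pairs\<close>

definition bilinear_on ::
    "('k::field \<Rightarrow> 'a::ab_group_add \<Rightarrow> 'a) \<Rightarrow> ('k \<Rightarrow> 'b::ab_group_add \<Rightarrow> 'b)
      \<Rightarrow> ('k \<Rightarrow> 'c::ab_group_add \<Rightarrow> 'c) \<Rightarrow> ('a \<Rightarrow> 'b \<Rightarrow> 'c) \<Rightarrow> bool" where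
  "bilinear_on sa sb sc f \<longleftrightarrow>
     (\<forall>x. Vector_Spaces.linear sb sc (f x)) \<and> (\<forall>y. Vector_Spaces.linear sa sc (\<lambda>x. f x y))"

locale pre_lie_algebra = vector_space sg
  for sg :: "'k::field \<Rightarrow> 'g::ab_group_add \<Rightarrow> 'g" +
  fixes prd :: "'g \<Rightarrow> 'g \<Rightarrow> 'g"
  assumes prd_bilinear: "bilinear_on sg sg sg prd"
    and left_symmetric:
      "prd (prd x y) z - prd x (prd y z) = prd (prd y x) z - prd y (prd x z)"
begin

definition bracket :: "'g \<Rightarrow> 'g \<Rightarrow> 'g" where
  "bracket x y = prd x y - prd y x"

end

text \<open>\<open>\<rho> x v\<close> and \<open>\<mu> x v\<close> stand for \<open>\<rho>(x)v\<close> and \<open>\<mu>(x)v\<close>.\<close>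

locale pre_lie_representation = pre_lie_algebra sg prd + V: vector_space sv
  for sg :: "'k::field \<Rightarrow> 'g::ab_group_add \<Rightarrow> 'g" and prd :: "'g \<Rightarrow> 'g \<Rightarrow> 'g"
    and sv :: "'k \<Rightarrow> 'v::ab_group_add \<Rightarrow> 'v" +
  fixes \<rho> \<mu> :: "'g \<Rightarrow> 'v \<Rightarrow> 'v"
  assumes rho_bilinear: "bilinear_on sg sv sv \<rho>"
    and mu_bilinear: "bilinear_on sg sv sv \<mu>"
    and rho_bracket: "\<rho> (bracket x y) v = \<rho> x (\<rho> y v) - \<rho> y (\<rho> x v)"
    and mu_rho: "\<mu> y (\<mu> x v) - \<mu> (prd x y) v = \<mu> y (\<rho> x v) - \<rho> x (\<mu> y v)"

locale pre_LieDer_pair = pre_lie_representation sg prd sv \<rho> \<mu>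
  for sg :: "'k::field \<Rightarrow> 'g::ab_group_add \<Rightarrow> 'g"
    and sv :: "'k \<Rightarrow> 'v::ab_group_add \<Rightarrow> 'v"
    and prd :: "'g \<Rightarrow> 'g \<Rightarrow> 'g" and D :: "'g \<Rightarrow> 'v" and \<rho> \<mu> :: "'g \<Rightarrow> 'v \<Rightarrow> 'v" +
  assumes D_linear: "Vector_Spaces.linear sg sv D"
    and D_derivation: "D (prd x y) = \<rho> x (D y) + \<mu> y (D x)"

definition pre_LieDer_hom ::
    "('k::field \<Rightarrow> 'g::ab_group_add \<Rightarrow> 'g) \<Rightarrow> ('k \<Rightarrow> 'v::ab_group_add \<Rightarrow> 'v)
      \<Rightarrow> ('g \<Rightarrow> 'g \<Rightarrow> 'g) \<times> ('g \<Rightarrow> 'v) \<times> ('g \<Rightarrow> 'v \<Rightarrow> 'v) \<times> ('g \<Rightarrow> 'v \<Rightarrow> 'v)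
      \<Rightarrow> ('g \<Rightarrow> 'g \<Rightarrow> 'g) \<times> ('g \<Rightarrow> 'v) \<times> ('g \<Rightarrow> 'v \<Rightarrow> 'v) \<times> ('g \<Rightarrow> 'v \<Rightarrow> 'v)
      \<Rightarrow> ('g \<Rightarrow> 'g) \<Rightarrow> ('v \<Rightarrow> 'v) \<Rightarrow> bool" where
  "pre_LieDer_hom sg sv = (\<lambda>(prd', D', \<rho>', \<mu>') (prd, D, \<rho>, \<mu>) \<phi> \<psi>.
     Vector_Spaces.linear sg sg \<phi> \<and> Vector_Spaces.linear sv sv \<psi> \<and>
     (\<forall>x y. \<phi> (prd' x y) = prd (\<phi> x) (\<phi> y)) \<and>
     (\<forall>x v. \<psi> (\<rho>' x v) = \<rho> (\<phi> x) (\<psi> v)) \<and>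
     (\<forall>x v. \<psi> (\<mu>' x v) = \<mu> (\<phi> x) (\<psi> v)) \<and>
     (\<forall>x. \<psi> (D' x) = D (\<phi> x)))"

section \<open>Infinitesimal deformations\<close>

text \<open>
  \<open>\<tau> : V \<otimes> \<gg> \<rightarrow> V\<close> takes the vector first, whereas \<open>\<mu>\<close> takes the algebra element first;
  hence the swap in \<open>\<mu>\<^sub>t(x)v = \<mu>(x)v + t \<tau>(v,x)\<close>.
\<close>

definition deform ::
    "('k::field \<Rightarrow> 'g::ab_group_add \<Rightarrow> 'g) \<Rightarrow> ('k \<Rightarrow> 'v::ab_group_add \<Rightarrow> 'v)
      \<Rightarrow> ('g \<Rightarrow> 'g \<Rightarrow> 'g) \<Rightarrow> ('g \<Rightarrow> 'v) \<Rightarrow> ('g \<Rightarrow> 'v \<Rightarrow> 'v) \<Rightarrow> ('g \<Rightarrow> 'v \<Rightarrow> 'v)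
      \<Rightarrow> ('g \<Rightarrow> 'g \<Rightarrow> 'g) \<Rightarrow> ('g \<Rightarrow> 'v \<Rightarrow> 'v) \<Rightarrow> ('v \<Rightarrow> 'g \<Rightarrow> 'v) \<Rightarrow> ('g \<Rightarrow> 'v) \<Rightarrow> 'k
      \<Rightarrow> ('g \<Rightarrow> 'g \<Rightarrow> 'g) \<times> ('g \<Rightarrow> 'v) \<times> ('g \<Rightarrow> 'v \<Rightarrow> 'v) \<times> ('g \<Rightarrow> 'v \<Rightarrow> 'v)" where
  "deform sg sv prd D \<rho> \<mu> \<omega> \<sigma> \<tau> Dh t =
     (\<lambda>x y. prd x y + sg t (\<omega> x y),
      \<lambda>x. D x + sv t (Dh x),
      \<lambda>x v. \<rho> x v + sv t (\<sigma> x v),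
      \<lambda>x v. \<mu> x v + sv t (\<tau> v x))"

definition infinitesimal_deformation ::
    "('k::field \<Rightarrow> 'g::ab_group_add \<Rightarrow> 'g) \<Rightarrow> ('k \<Rightarrow> 'v::ab_group_add \<Rightarrow> 'v)
      \<Rightarrow> ('g \<Rightarrow> 'g \<Rightarrow> 'g) \<Rightarrow> ('g \<Rightarrow> 'v) \<Rightarrow> ('g \<Rightarrow> 'v \<Rightarrow> 'v) \<Rightarrow> ('g \<Rightarrow> 'v \<Rightarrow> 'v)
      \<Rightarrow> ('g \<Rightarrow> 'g \<Rightarrow> 'g) \<Rightarrow> ('g \<Rightarrow> 'v \<Rightarrow> 'v) \<Rightarrow> ('v \<Rightarrow> 'g \<Rightarrow> 'v) \<Rightarrow> ('g \<Rightarrow> 'v) \<Rightarrow> bool" where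
  "infinitesimal_deformation sg sv prd D \<rho> \<mu> \<omega> \<sigma> \<tau> Dh \<longleftrightarrow>
     bilinear_on sg sg sg \<omega> \<and> bilinear_on sg sv sv \<sigma> \<and> bilinear_on sv sg sv \<tau> \<and>
     Vector_Spaces.linear sg sv Dh \<and>
     (\<forall>t. case deform sg sv prd D \<rho> \<mu> \<omega> \<sigma> \<tau> Dh t of (prd\<^sub>t, D\<^sub>t, \<rho>\<^sub>t, \<mu>\<^sub>t) \<Rightarrow>
        pre_LieDer_pair sg sv prd\<^sub>t D\<^sub>t \<rho>\<^sub>t \<mu>\<^sub>t)"

definition equivalent_deformations ::
    "('k::field \<Rightarrow> 'g::ab_group_add \<Rightarrow> 'g) \<Rightarrow> ('k \<Rightarrow> 'v::ab_group_add \<Rightarrow> 'v)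
      \<Rightarrow> ('k \<Rightarrow> ('g \<Rightarrow> 'g \<Rightarrow> 'g) \<times> ('g \<Rightarrow> 'v) \<times> ('g \<Rightarrow> 'v \<Rightarrow> 'v) \<times> ('g \<Rightarrow> 'v \<Rightarrow> 'v))
      \<Rightarrow> ('k \<Rightarrow> ('g \<Rightarrow> 'g \<Rightarrow> 'g) \<times> ('g \<Rightarrow> 'v) \<times> ('g \<Rightarrow> 'v \<Rightarrow> 'v) \<times> ('g \<Rightarrow> 'v \<Rightarrow> 'v))
      \<Rightarrow> bool" where
  "equivalent_deformations sg sv A' A \<longleftrightarrow>
     (\<exists>N S. Vector_Spaces.linear sg sg N \<and> Vector_Spaces.linear sv sv S \<and>
        (\<forall>t. pre_LieDer_hom sg sv (A' t) (A t) (\<lambda>x. x + sg t (N x)) (\<lambda>v. v + sv t (S v))))"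

section \<open>The Matsushima-Nijenhuis bracket\<close>

text \<open>
  A map \<open>\<And>\<^sup>k A \<otimes> B \<rightarrow> C\<close> is represented by \<open>f :: 'a list \<Rightarrow> 'b \<Rightarrow> 'c\<close>: the list holds
  the \<open>k\<close> skew-symmetric arguments and the last argument is separate. To make the representation
  unique, \<open>f\<close> is zero on lists of length other than \<open>k\<close>.
  So \<open>C\<^sup>n(W;W)\<close> is \<open>Hom_wedge s s s (n - 1)\<close>.
\<close>

definition Hom_wedge ::
    "('k::field \<Rightarrow> 'a::ab_group_add \<Rightarrow> 'a) \<Rightarrow> ('k \<Rightarrow> 'b::ab_group_add \<Rightarrow> 'b)
      \<Rightarrow> ('k \<Rightarrow> 'c::ab_group_add \<Rightarrow> 'c) \<Rightarrow> nat \<Rightarrow> ('a list \<Rightarrow> 'b \<Rightarrow> 'c) set" where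
  "Hom_wedge sa sb sc k = {f.
     (\<forall>xs y. length xs \<noteq> k \<longrightarrow> f xs y = 0) \<and>
     (\<forall>xs. length xs = k \<longrightarrow> Vector_Spaces.linear sb sc (f xs)) \<and>
     (\<forall>xs y i. length xs = k \<and> i < k \<longrightarrow> Vector_Spaces.linear sa sc (\<lambda>x. f (xs[i := x]) y)) \<and>
     (\<forall>xs y i j. length xs = k \<and> i < j \<and> j < k \<and> xs ! i = xs ! j \<longrightarrow> f xs y = 0)}"

text \<open>\<open>\<And>\<^sup>k A \<otimes> B \<otimes> B' \<rightarrow> C\<close>\<close>

definition Hom_wedge2 ::
    "('k::field \<Rightarrow> 'a::ab_group_add \<Rightarrow> 'a) \<Rightarrow> ('k \<Rightarrow> 'b::ab_group_add \<Rightarrow> 'b)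
      \<Rightarrow> ('k \<Rightarrow> 'd::ab_group_add \<Rightarrow> 'd) \<Rightarrow> ('k \<Rightarrow> 'c::ab_group_add \<Rightarrow> 'c)
      \<Rightarrow> nat \<Rightarrow> ('a list \<Rightarrow> 'b \<Rightarrow> 'd \<Rightarrow> 'c) set" where
  "Hom_wedge2 sa sb sd sc k = {f.
     (\<forall>z. (\<lambda>xs y. f xs y z) \<in> Hom_wedge sa sb sc k) \<and>
     (\<forall>xs y. Vector_Spaces.linear sd sc (f xs y))}"

text \<open>
  Permutations of \<open>{0..<k\<^sub>1 + ... + k\<^sub>r}\<close> (so indices are shifted down by one) that are
  increasing on each of the consecutive blocks of lengths \<open>k\<^sub>1, ..., k\<^sub>r\<close>.
\<close>

definition unshuffles :: "nat list \<Rightarrow> (nat \<Rightarrow> nat) set" where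
  "unshuffles ks = {\<pi>. \<pi> permutes {0..<sum_list ks} \<and>
     (\<forall>j<length ks. strict_mono_on {sum_list (take j ks)..<sum_list (take (Suc j) ks)} \<pi>)}"

text \<open>\<open>P \<circ> Q\<close> for \<open>P \<in> C\<^sup>p\<^sup>+\<^sup>1(W;W)\<close> and \<open>Q \<in> C\<^sup>q\<^sup>+\<^sup>1(W;W)\<close>; the last argument \<open>w\<close> is \<open>x\<^sub>p\<^sub>+\<^sub>q\<^sub>+\<^sub>1\<close>.\<close>

definition MN_circ ::
    "('k::field \<Rightarrow> 'w::ab_group_add \<Rightarrow> 'w) \<Rightarrow> nat \<Rightarrow> nat
      \<Rightarrow> ('w list \<Rightarrow> 'w \<Rightarrow> 'w) \<Rightarrow> ('w list \<Rightarrow> 'w \<Rightarrow> 'w) \<Rightarrow> ('w list \<Rightarrow> 'w \<Rightarrow> 'w)" where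
  "MN_circ s p q P Q = (\<lambda>xs w.
     if length xs \<noteq> p + q then 0
     else
       (if p = 0 then 0
        else \<Sum>\<pi>\<in>unshuffles [q, 1, p - 1]. s (of_int (sign \<pi>))
               (P (Q (map (\<lambda>i. xs ! \<pi> i) [0..<q]) (xs ! \<pi> q)
                    # map (\<lambda>i. xs ! \<pi> i) [q + 1..<p + q]) w))
       + s ((-1) ^ (p * q))
           (\<Sum>\<pi>\<in>unshuffles [p, q]. s (of_int (sign \<pi>))
              (P (map (\<lambda>i. xs ! \<pi> i) [0..<p]) (Q (map (\<lambda>i. xs ! \<pi> i) [p..<p + q]) w))))"

definition MN_bracket ::
    "('k::field \<Rightarrow> 'w::ab_group_add \<Rightarrow> 'w) \<Rightarrow> nat \<Rightarrow> nat
      \<Rightarrow> ('w list \<Rightarrow> 'w \<Rightarrow> 'w) \<Rightarrow> ('w list \<Rightarrow> 'w \<Rightarrow> 'w) \<Rightarrow> ('w list \<Rightarrow> 'w \<Rightarrow> 'w)" where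
  "MN_bracket s p q P Q = (\<lambda>xs w.
     MN_circ s p q P Q xs w - s ((-1) ^ (p * q)) (MN_circ s q p Q P xs w))"

section \<open>Horizontal lifts to \<open>W = \<gg> \<oplus> V\<close>\<close>

definition lift_g ::
    "('g list \<Rightarrow> 'g \<Rightarrow> 'g) \<Rightarrow> (('g \<times> 'v::zero) list \<Rightarrow> 'g \<times> 'v \<Rightarrow> 'g \<times> 'v)" where
  "lift_g f = (\<lambda>ws w. (f (map fst ws) (fst w), 0))"

definition lift_gV ::
    "('g list \<Rightarrow> 'g \<Rightarrow> 'v) \<Rightarrow> (('g::zero \<times> 'v) list \<Rightarrow> 'g \<times> 'v \<Rightarrow> 'g \<times> 'v)" where
  "lift_gV f = (\<lambda>ws w. (0, f (map fst ws) (fst w)))"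

definition lift_rho ::
    "('g list \<Rightarrow> 'v \<Rightarrow> 'v) \<Rightarrow> (('g::zero \<times> 'v) list \<Rightarrow> 'g \<times> 'v \<Rightarrow> 'g \<times> 'v)" where
  "lift_rho f = (\<lambda>ws w. (0, f (map fst ws) (snd w)))"

text \<open>With \<open>m - 1 = length ws\<close> and \<open>i\<close> starting at 0, the sign \<open>(-1)\<^bsup>m-1-i\<^esup>\<close> has exponent
  \<open>length ws - Suc i\<close>.\<close>

definition lift_mu ::
    "('k::field \<Rightarrow> 'v::ab_group_add \<Rightarrow> 'v) \<Rightarrow> ('g list \<Rightarrow> 'v \<Rightarrow> 'g \<Rightarrow> 'v)
      \<Rightarrow> (('g::zero \<times> 'v) list \<Rightarrow> 'g \<times> 'v \<Rightarrow> 'g \<times> 'v)" where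
  "lift_mu sv f = (\<lambda>ws w. (0, \<Sum>i<length ws. sv ((-1) ^ (length ws - Suc i))
     (f (map fst (take i ws @ drop (Suc i) ws)) (snd (ws ! i)) (fst w))))"

section \<open>Cohomology of a pre-LieDer pair\<close>

text \<open>Linear and bilinear maps as multilinear maps in the list representation.\<close>

definition unary :: "('b \<Rightarrow> 'c::zero) \<Rightarrow> 'a list \<Rightarrow> 'b \<Rightarrow> 'c" where
  "unary f = (\<lambda>xs y. case xs of [] \<Rightarrow> f y | _ \<Rightarrow> 0)"

definition binary :: "('a \<Rightarrow> 'b \<Rightarrow> 'c::zero) \<Rightarrow> 'a list \<Rightarrow> 'b \<Rightarrow> 'c" where
  "binary f = (\<lambda>xs y. case xs of [x] \<Rightarrow> f x y | _ \<Rightarrow> 0)"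

definition binary_V :: "('b \<Rightarrow> 'd \<Rightarrow> 'c::zero) \<Rightarrow> 'a list \<Rightarrow> 'b \<Rightarrow> 'd \<Rightarrow> 'c" where
  "binary_V f = (\<lambda>xs v y. case xs of [] \<Rightarrow> f v y | _ \<Rightarrow> 0)"

type_synonym ('g, 'v) cochain =
  "(('g \<times> 'v) list \<Rightarrow> 'g \<times> 'v \<Rightarrow> 'g \<times> 'v) \<times> (('g \<times> 'v) list \<Rightarrow> 'g \<times> 'v \<Rightarrow> 'g \<times> 'v)"

text \<open>
  An \<open>n\<close>-cochain \<open>(f, \<theta>)\<close> is stored as the pair of its horizontal lifts. The sum
  \<open>f\<^sub>\<pi> + f\<^sub>\<rho> + f\<^sub>\<mu>\<close> of lifts determines its three components (restrict to
  arguments in \<open>\<gg>\<close> or in \<open>V\<close>), so these sets are isomorphic to the direct sums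
  that they represent.
\<close>

definition cochains ::
    "('k::field \<Rightarrow> 'g::ab_group_add \<Rightarrow> 'g) \<Rightarrow> ('k \<Rightarrow> 'v::ab_group_add \<Rightarrow> 'v)
      \<Rightarrow> nat \<Rightarrow> ('g, 'v) cochain set" where
  "cochains sg sv n =
     (if n = 0 then {0}
      else if n = 1 then
        {(lift_g f\<^sub>\<pi> + lift_rho f\<^sub>\<rho>, 0) | f\<^sub>\<pi> f\<^sub>\<rho>.
           f\<^sub>\<pi> \<in> Hom_wedge sg sg sg 0 \<and> f\<^sub>\<rho> \<in> Hom_wedge sg sv sv 0}
      else
        {(lift_g f\<^sub>\<pi> + lift_rho f\<^sub>\<rho> + lift_mu sv f\<^sub>\<mu>, lift_gV \<theta>) | f\<^sub>\<pi> f\<^sub>\<rho> f\<^sub>\<mu> \<theta>.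
           f\<^sub>\<pi> \<in> Hom_wedge sg sg sg (n - 1) \<and> f\<^sub>\<rho> \<in> Hom_wedge sg sv sv (n - 1) \<and>
           f\<^sub>\<mu> \<in> Hom_wedge2 sg sv sg sv (n - 2) \<and> \<theta> \<in> Hom_wedge sg sg sv (n - 2)})"

text \<open>
  \<open>\<pi> + \<rho> + \<mu>\<close> and \<open>f\<close> have degrees \<open>2\<close> and \<open>n\<close>, \<open>\<theta>\<close> and \<open>D\<close> have degrees \<open>n - 1\<close> and \<open>1\<close>
  in \<open>C\<^sup>*(W;W)\<close>, while the bracket is indexed by degrees minus one. For \<open>n = 1\<close> one has \<open>\<theta> = 0\<close>,
  so the truncated value of \<open>n - 2\<close> is irrelevant there.
\<close>

definition coboundary ::
    "('k::field \<Rightarrow> 'g::ab_group_add \<Rightarrow> 'g) \<Rightarrow> ('k \<Rightarrow> 'v::ab_group_add \<Rightarrow> 'v)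
      \<Rightarrow> ('g \<Rightarrow> 'g \<Rightarrow> 'g) \<Rightarrow> ('g \<Rightarrow> 'v) \<Rightarrow> ('g \<Rightarrow> 'v \<Rightarrow> 'v) \<Rightarrow> ('g \<Rightarrow> 'v \<Rightarrow> 'v)
      \<Rightarrow> nat \<Rightarrow> ('g, 'v) cochain \<Rightarrow> ('g, 'v) cochain" where
  "coboundary sg sv prd D \<rho> \<mu> n = (\<lambda>(f, \<theta>).
     if n = 0 then 0
     else
       let s = module_prod.scale sg sv;
           \<epsilon> = (-1) powi (int n - 2);
           M = lift_g (binary prd) + lift_rho (binary \<rho>) + lift_mu sv (binary_V (\<lambda>v x. \<mu> x v));
           \<Delta> = lift_gV (unary D)
       in (\<lambda>ws w. s \<epsilon> (- MN_bracket s 1 (n - 1) M f ws w),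
           \<lambda>ws w. s \<epsilon> (MN_bracket s 1 (n - 2) M \<theta> ws w + MN_bracket s (n - 1) 0 f \<Delta> ws w)))"

definition cocycles ::
    "('k::field \<Rightarrow> 'g::ab_group_add \<Rightarrow> 'g) \<Rightarrow> ('k \<Rightarrow> 'v::ab_group_add \<Rightarrow> 'v)
      \<Rightarrow> ('g \<Rightarrow> 'g \<Rightarrow> 'g) \<Rightarrow> ('g \<Rightarrow> 'v) \<Rightarrow> ('g \<Rightarrow> 'v \<Rightarrow> 'v) \<Rightarrow> ('g \<Rightarrow> 'v \<Rightarrow> 'v)
      \<Rightarrow> nat \<Rightarrow> ('g, 'v) cochain set" where
  "cocycles sg sv prd D \<rho> \<mu> n =
     {c \<in> cochains sg sv n. coboundary sg sv prd D \<rho> \<mu> n c = 0}"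

definition coboundaries ::
    "('k::field \<Rightarrow> 'g::ab_group_add \<Rightarrow> 'g) \<Rightarrow> ('k \<Rightarrow> 'v::ab_group_add \<Rightarrow> 'v)
      \<Rightarrow> ('g \<Rightarrow> 'g \<Rightarrow> 'g) \<Rightarrow> ('g \<Rightarrow> 'v) \<Rightarrow> ('g \<Rightarrow> 'v \<Rightarrow> 'v) \<Rightarrow> ('g \<Rightarrow> 'v \<Rightarrow> 'v)
      \<Rightarrow> nat \<Rightarrow> ('g, 'v) cochain set" where
  "coboundaries sg sv prd D \<rho> \<mu> n =
     (if n = 0 then {0} else coboundary sg sv prd D \<rho> \<mu> (n - 1) ` cochains sg sv (n - 1))"

definition cohomology ::
    "('k::field \<Rightarrow> 'g::ab_group_add \<Rightarrow> 'g) \<Rightarrow> ('k \<Rightarrow> 'v::ab_group_add \<Rightarrow> 'v)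
      \<Rightarrow> ('g \<Rightarrow> 'g \<Rightarrow> 'g) \<Rightarrow> ('g \<Rightarrow> 'v) \<Rightarrow> ('g \<Rightarrow> 'v \<Rightarrow> 'v) \<Rightarrow> ('g \<Rightarrow> 'v \<Rightarrow> 'v)
      \<Rightarrow> nat \<Rightarrow> ('g, 'v) cochain set set" where
  "cohomology sg sv prd D \<rho> \<mu> n =
     cocycles sg sv prd D \<rho> \<mu> n //
       {(a, b). a \<in> cocycles sg sv prd D \<rho> \<mu> n \<and> b \<in> cocycles sg sv prd D \<rho> \<mu> n \<and>
                a - b \<in> coboundaries sg sv prd D \<rho> \<mu> n}"

definition cochain_of_deformation ::
    "('k::field \<Rightarrow> 'v::ab_group_add \<Rightarrow> 'v)
      \<Rightarrow> ('g::ab_group_add \<Rightarrow> 'g \<Rightarrow> 'g) \<Rightarrow> ('g \<Rightarrow> 'v \<Rightarrow> 'v) \<Rightarrow> ('v \<Rightarrow> 'g \<Rightarrow> 'v) \<Rightarrow> ('g \<Rightarrow> 'v)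
      \<Rightarrow> ('g, 'v) cochain" where
  "cochain_of_deformation sv \<omega> \<sigma> \<tau> Dh =
     (lift_g (binary \<omega>) + lift_rho (binary \<sigma>) + lift_mu sv (binary_V \<tau>), lift_gV (unary Dh))"

end

theory Submission
  imports Defs
begin

text \<open>
  The lift of \<open>\<pi> + \<rho> + \<mu>\<close> is the product of the semidirect product \<open>\<gg> \<ltimes> V\<close>, and the lift
  of \<open>D\<close> is a derivation of it. Hence everything can be read off bilinear maps on one space:
  the coefficient of \<open>t\<close> in the pre-Lie identity and in the Leibniz rule for the deformed
  structure on \<open>\<gg> \<ltimes> V\<close> is the cocycle condition, and the coefficient of \<open>t\<close> in the homomorphism
  equations for \<open>Id + t (N \<oplus> S)\<close> says that the two deformations differ by the coboundary of
  \<open>(N, S)\<close>. The coefficient can be extracted because the identities, of degree at most 3 in \<open>t\<close>,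
  hold for all \<open>t\<close> in a field of characteristic 0.
\<close>

section \<open>Bilinear maps\<close>

lemma bilinear_on_simps:
  assumes "bilinear_on sa sb sc f"
  shows "f (x + y) z = f x z + f y z" "f x (z + w) = f x z + f x w"
    "f (sa t x) z = sc t (f x z)" "f x (sb t z) = sc t (f x z)"
    "f 0 z = 0" "f x 0 = 0"
  using assms unfolding bilinear_on_def Vector_Spaces.linear_iff
  by (metis add_cancel_right_left)+

lemma bilinear_on_vector_space:
  assumes "bilinear_on sa sb sc f"
  shows "vector_space sa" "vector_space sb" "vector_space sc"
  using assms by (auto simp: bilinear_on_def Vector_Spaces.linear_iff)

text \<open>Evaluating at \<open>t = 1, -1, 2\<close> gives \<open>6 c = 0\<close> and \<open>a = - c\<close>.\<close>

lemma linear_coefficient_eq_0: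
  fixes s :: "'k::field_char_0 \<Rightarrow> 'w::ab_group_add \<Rightarrow> 'w"
  assumes "vector_space s"
    and eq: "\<And>t. s t a + s (t\<^sup>2) b + s (t ^ 3) c = 0"
  shows "a = 0"
proof -
  interpret vector_space s by fact
  have 1: "a + b + c = 0"
    using eq[of 1] by simp
  have "b - (a + c) = 0"
    using eq[of "- 1"] by (simp add: algebra_simps)
  with 1 have "b + b = 0"
    by (simp add: algebra_simps)
  then have "s 2 b = 0"
    by (metis one_add_one scale_left_distrib scale_one)
  then have b: "b = 0"
    by simp
  with 1 have ac: "a = - c"
    by (simp add: eq_neg_iff_add_eq_0)
  have "s 6 c = s 2 a + s (2 ^ 3) c"
    unfolding ac scale_minus_right scale_minus_left[symmetric] scale_left_distrib[symmetric]
    by simp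
  also have "\<dots> = 0"
    using eq[of 2] b by simp
  finally show ?thesis
    by (simp add: ac)
qed

section \<open>The Matsushima-Nijenhuis bracket in low degrees\<close>

lemma permutes_lessThan_1: "\<pi> permutes {0..<Suc 0} \<longleftrightarrow> \<pi> = id"
  by (simp add: atLeast0LessThan lessThan_Suc)

lemma permutes_lessThan_2: "\<pi> permutes {0..<Suc (Suc 0)} \<longleftrightarrow> \<pi> = id \<or> \<pi> = transpose 0 1"
proof -
  have "{0..<Suc (Suc 0)} = {0, 1::nat}" by auto
  then show ?thesis by (simp add: permutes_doubleton_iff)
qed

lemma strict_mono_on_singleton: "strict_mono_on {n} (f :: nat \<Rightarrow> nat)"
  by (rule strict_mono_onI) auto

text \<open>These are the block lengths \<open>[q, 1, p - 1]\<close> and \<open>[p, q]\<close>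
  arising for p, q \<le> 1. All blocks have length at most one, so the monotonicity condition is
  void and every permutation qualifies.\<close>

lemma unshuffles_low:
  "unshuffles [0, 0] = {id}"
  "unshuffles [Suc 0, 0] = {id}"
  "unshuffles [0, Suc 0] = {id}"
  "unshuffles [0, Suc 0, 0] = {id}"
  "unshuffles [Suc 0, Suc 0] = {id, transpose 0 1}"
  "unshuffles [Suc 0, Suc 0, 0] = {id, transpose 0 1}"
  by (auto simp: unshuffles_def permutes_lessThan_1 permutes_lessThan_2 less_Suc_eq
      strict_mono_on_singleton strict_mono_on_id)

lemma id_neq_transpose_0_1: "id \<noteq> transpose 0 (Suc 0)"
  by (metis One_nat_def id_apply transpose_apply_first zero_neq_one)

context vector_space
begin

text \<open>For p = q = 1 the sign \<open>(-1) ^ (p * q)\<close> turns the difference of the two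
  circle products into a sum. The result is the polarised left-symmetry identity; for
  \<open>m = n\<close> it is twice the skew-symmetrised associator of \<open>m\<close>.\<close>

lemma MN_bracket_binary_binary:
  "MN_bracket scale (Suc 0) (Suc 0) (binary m) (binary n) = (\<lambda>xs c. case xs of [a, b] \<Rightarrow>
     m (n a b) c - m (n b a) c - m a (n b c) + m b (n a c)
     + n (m a b) c - n (m b a) c - n a (m b c) + n b (m a c) | _ \<Rightarrow> 0)"
  by (intro ext) (auto simp: MN_bracket_def MN_circ_def unshuffles_low binary_def sign_swap_id
      id_neq_transpose_0_1 algebra_simps split: list.split)

text \<open>The bracket measures the failure of \<open>d\<close> to be a derivation of
  \<open>m\<close>.\<close>

lemma MN_bracket_binary_unary:
  "MN_bracket scale (Suc 0) 0 (binary m) (unary d) = binary (\<lambda>a b. m (d a) b + m a (d b) - d (m a b))"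
  by (auto simp: MN_bracket_def MN_circ_def unshuffles_low binary_def unary_def fun_eq_iff
      length_Suc_conv split: list.split)

lemma MN_bracket_unary_unary:
  "MN_bracket scale 0 0 (unary f) (unary d) = unary (\<lambda>a. f (d a) - d (f a))"
  by (auto simp: MN_bracket_def MN_circ_def unshuffles_low unary_def fun_eq_iff split: list.split)

end

section \<open>Semidirect products\<close>

text \<open>For a representation this is the pre-Lie algebra on the direct sum of the algebra and V
  in which V is an ideal with zero product.\<close>

definition semidirect :: "('g \<Rightarrow> 'g \<Rightarrow> 'g) \<Rightarrow> ('g \<Rightarrow> 'v \<Rightarrow> 'v) \<Rightarrow> ('g \<Rightarrow> 'v \<Rightarrow> 'v)
    \<Rightarrow> 'g \<times> 'v \<Rightarrow> 'g \<times> 'v \<Rightarrow> 'g \<times> 'v::plus" where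
  "semidirect p r m a b = (p (fst a) (fst b), r (fst a) (snd b) + m (fst b) (snd a))"

definition horizontal :: "('g \<Rightarrow> 'v) \<Rightarrow> 'g \<times> 'v \<Rightarrow> 'g::zero \<times> 'v" where
  "horizontal d a = (0, d (fst a))"

lemma binary_eq_0: "length xs \<noteq> 1 \<Longrightarrow> binary f xs = (\<lambda>_. 0)"
  by (auto simp: binary_def fun_eq_iff split: list.split)

text \<open>On a singleton, \<open>lift_mu\<close> has a single summand with sign +1 and no wedge
  arguments left. On longer lists, deleting one entry leaves a nonempty list, where
  \<open>binary_V\<close> vanishes.\<close>

lemma semidirect_lift:
  fixes p :: "'g::ab_group_add \<Rightarrow> 'g \<Rightarrow> 'g" and sv :: "'k::field \<Rightarrow> 'v::ab_group_add \<Rightarrow> 'v"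
  assumes "vector_space sv"
  shows "lift_g (binary p) + lift_rho (binary r) + lift_mu sv (binary_V m)
    = binary (semidirect p r (\<lambda>x v. m v x))"
proof -
  interpret vector_space sv by fact
  show ?thesis (is "?l = ?r")
  proof (intro ext)
    fix ws :: "('g \<times> 'v) list" and w
    \<comment> \<open>The equations of \<open>remdups_adj\<close> distinguish exactly empty lists,
      singletons and lists with at least two entries.\<close>
    consider "ws = []" | a where "ws = [a]" | "length ws > 1"
      by (cases ws rule: remdups_adj.cases) auto
    then show "?l ws w = ?r ws w"
    proof cases
      case 3
      have "sv ((-1) ^ (length ws - Suc i)) (binary_V m (map fst (take i ws @ drop (Suc i) ws))
        (snd (ws ! i)) (fst w)) = 0" if "i < length ws" for i
      proof -
        have "length (map fst (take i ws @ drop (Suc i) ws)) \<noteq> 0"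
          using that 3 by simp
        then show ?thesis
          by (cases "map fst (take i ws @ drop (Suc i) ws)") (simp_all add: binary_V_def)
      qed
      then show ?thesis
        using 3 by (simp add: lift_g_def lift_rho_def lift_mu_def zero_prod_def binary_eq_0)
    qed (auto simp: lift_g_def lift_rho_def lift_mu_def binary_def binary_V_def semidirect_def
        zero_prod_def)
  qed
qed

lemma horizontal_lift: "lift_gV (unary d) = unary (horizontal d)"
  by (auto simp: lift_gV_def unary_def horizontal_def fun_eq_iff zero_prod_def split: list.split)

lemma map_prod_lift:
  fixes N :: "'g::ab_group_add \<Rightarrow> 'g" and S :: "'v::ab_group_add \<Rightarrow> 'v"
  shows "lift_g (unary N) + lift_rho (unary S) = unary (map_prod N S)"
  by (auto simp: lift_g_def lift_rho_def unary_def fun_eq_iff zero_prod_def split: list.split)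

lemma bilinear_on_semidirect:
  assumes "bilinear_on sg sg sg p" "bilinear_on sg sv sv r" "bilinear_on sg sv sv m"
  shows "bilinear_on (module_prod.scale sg sv) (module_prod.scale sg sv) (module_prod.scale sg sv)
    (semidirect p r m)"
proof -
  interpret vector_space_prod sg sv
    using assms by (intro vector_space_prod.intro vector_space_pair.intro bilinear_on_vector_space)
  show ?thesis
    unfolding bilinear_on_def Vector_Spaces.linear_iff using p.vector_space_axioms
    by (auto simp: semidirect_def scale_def bilinear_on_simps[OF assms(1)]
        bilinear_on_simps[OF assms(2)] bilinear_on_simps[OF assms(3)] algebra_simps)
qed

lemma linear_horizontal:
  assumes "Vector_Spaces.linear sg sv d"
  shows "Vector_Spaces.linear (module_prod.scale sg sv) (module_prod.scale sg sv) (horizontal d)"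
proof -
  interpret d: Vector_Spaces.linear sg sv d by fact
  interpret vector_space_prod sg sv ..
  show ?thesis
    unfolding Vector_Spaces.linear_iff using p.vector_space_axioms
    by (auto simp: horizontal_def scale_def d.add d.scale)
qed

lemma linear_map_prod:
  assumes "Vector_Spaces.linear sg sg N" "Vector_Spaces.linear sv sv S"
  shows "Vector_Spaces.linear (module_prod.scale sg sv) (module_prod.scale sg sv) (map_prod N S)"
proof -
  interpret N: Vector_Spaces.linear sg sg N by fact
  interpret S: Vector_Spaces.linear sv sv S by fact
  interpret vector_space_prod sg sv ..
  show ?thesis
    unfolding Vector_Spaces.linear_iff using p.vector_space_axioms
    by (auto simp: scale_def N.add N.scale S.add S.scale)
qed

text \<open>The algebra component is left symmetry of \<open>prd\<close>. In the V component, the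
  terms in \<open>snd c\<close> match by \<open>rho_bracket\<close>, those in \<open>snd a\<close>
  and \<open>snd b\<close> by \<open>mu_rho\<close>.\<close>

lemma (in pre_lie_representation) pre_lie_algebra_semidirect:
  "pre_lie_algebra (module_prod.scale sg sv) (semidirect prd \<rho> \<mu>)"
proof -
  interpret vector_space_prod sg sv ..
  note simps = bilinear_on_simps[OF rho_bilinear] bilinear_on_simps[OF mu_bilinear]
  show ?thesis
  proof
    show "bilinear_on scale scale scale (semidirect prd \<rho> \<mu>)"
      by (intro bilinear_on_semidirect prd_bilinear rho_bilinear mu_bilinear)
    fix a b c :: "'g \<times> 'v"
    \<comment> \<open>Additivity of \<rho> is applied to \<open>bracket x y + prd y x\<close>, which
      equals \<open>prd x y\<close>.\<close>
    have br: "\<rho> (prd x y) v - \<rho> (prd y x) v = \<rho> x (\<rho> y v) - \<rho> y (\<rho> x v)" for x y v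
      using rho_bracket[of x y v] bilinear_on_simps(1)[OF rho_bilinear, of "bracket x y" "prd y x" v]
      by (simp add: bracket_def algebra_simps)
    \<comment> \<open>\<open>mu_rho\<close> is oriented as a rewrite rule that removes nested
      \<mu>.\<close>
    have mr: "\<mu> z (\<mu> y v) = \<mu> (prd y z) v + \<mu> z (\<rho> y v) - \<rho> y (\<mu> z v)" for y z v
      using mu_rho[of z y v] by (simp add: algebra_simps)
    show "semidirect prd \<rho> \<mu> (semidirect prd \<rho> \<mu> a b) c - semidirect prd \<rho> \<mu> a (semidirect prd \<rho> \<mu> b c)
      = semidirect prd \<rho> \<mu> (semidirect prd \<rho> \<mu> b a) c - semidirect prd \<rho> \<mu> b (semidirect prd \<rho> \<mu> a c)"
      using left_symmetric[of "fst a" "fst b" "fst c"] br[of "fst a" "fst b" "snd c"]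
      by (simp add: semidirect_def simps mr algebra_simps)
  qed
qed

lemma (in pre_LieDer_pair) horizontal_derivation:
  "horizontal D (semidirect prd \<rho> \<mu> a b)
    = semidirect prd \<rho> \<mu> (horizontal D a) b + semidirect prd \<rho> \<mu> a (horizontal D b)"
  by (simp add: semidirect_def horizontal_def D_derivation bilinear_on_simps[OF prd_bilinear]
      bilinear_on_simps[OF rho_bilinear] bilinear_on_simps[OF mu_bilinear] add.commute)

section \<open>Linear coefficients of deformations\<close>

text \<open>Left symmetry of \<open>m + t n\<close> is quadratic in t, and its t-coefficient is the
  bracket of \<open>m\<close> and \<open>n\<close> from
  \<open>MN_bracket_binary_binary\<close>.\<close>

lemma pre_lie_deformation_linear_coefficient:
  fixes s :: "'k::field_char_0 \<Rightarrow> 'w::ab_group_add \<Rightarrow> 'w"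
  assumes m: "bilinear_on s s s m" and n: "bilinear_on s s s n"
    and pre_lie: "\<And>t. pre_lie_algebra s (\<lambda>a b. m a b + s t (n a b))"
  shows "m (n a b) c - m (n b a) c - m a (n b c) + m b (n a c)
    + n (m a b) c - n (m b a) c - n a (m b c) + n b (m a c) = 0"
proof -
  interpret vector_space s
    using m by (rule bilinear_on_vector_space)
  let ?p0 = "m (m a b) c - m a (m b c) - m (m b a) c + m b (m a c)"
  let ?p1 = "m (n a b) c - m (n b a) c - m a (n b c) + m b (n a c)
    + n (m a b) c - n (m b a) c - n a (m b c) + n b (m a c)"
  let ?p2 = "n (n a b) c - n a (n b c) - n (n b a) c + n b (n a c)"
  have expand: "?p0 + s t ?p1 + s (t\<^sup>2) ?p2 = 0" for t
    using pre_lie_algebra.left_symmetric[OF pre_lie, of a b t c]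
    by (simp add: bilinear_on_simps[OF m] bilinear_on_simps[OF n] algebra_simps power2_eq_square)
  \<comment> \<open>At t = 0 the identity is left symmetry of \<open>m\<close> itself, so the
    constant term drops out for every t.\<close>
  have "?p0 = 0"
    using expand[of 0] by simp
  show ?thesis
  proof (rule linear_coefficient_eq_0[OF vector_space_axioms])
    show "s t ?p1 + s (t\<^sup>2) ?p2 + s (t ^ 3) 0 = 0" for t
      using expand[of t] unfolding \<open>?p0 = 0\<close>
      by (simp only: add_0_left add_0_right scale_zero_right)
  qed
qed

text \<open>The t-coefficient of the Leibniz rule for \<open>d + t e\<close> and
  \<open>m + t n\<close> is the sum of the brackets of \<open>m\<close> with \<open>e\<close> and of
  \<open>n\<close> with \<open>d\<close>, the shape of the second component of the coboundary in
  degree 2.\<close>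

lemma derivation_deformation_linear_coefficient:
  fixes s :: "'k::field_char_0 \<Rightarrow> 'w::ab_group_add \<Rightarrow> 'w"
  assumes m: "bilinear_on s s s m" and n: "bilinear_on s s s n"
    and d: "Vector_Spaces.linear s s d" and e: "Vector_Spaces.linear s s e"
    and derivation: "\<And>t a b. d (m a b + s t (n a b)) + s t (e (m a b + s t (n a b)))
      = m (d a + s t (e a)) b + s t (n (d a + s t (e a)) b)
        + (m a (d b + s t (e b)) + s t (n a (d b + s t (e b))))"
  shows "m (e a) b + m a (e b) - e (m a b) + (n (d a) b + n a (d b) - d (n a b)) = 0"
proof -
  interpret vector_space s
    using m by (rule bilinear_on_vector_space)
  interpret d: Vector_Spaces.linear s s d by fact
  interpret e: Vector_Spaces.linear s s e by fact
  let ?p0 = "m (d a) b + m a (d b) - d (m a b)"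
  let ?p1 = "m (e a) b + m a (e b) - e (m a b) + (n (d a) b + n a (d b) - d (n a b))"
  let ?p2 = "n (e a) b + n a (e b) - e (n a b)"
  have expand: "?p0 + s t ?p1 + s (t\<^sup>2) ?p2 = 0" for t
    using derivation[of a b t]
    by (simp add: bilinear_on_simps[OF m] bilinear_on_simps[OF n] d.add d.scale e.add e.scale
        algebra_simps power2_eq_square)
  have "?p0 = 0"
    using expand[of 0] by simp
  show ?thesis
  proof (rule linear_coefficient_eq_0[OF vector_space_axioms])
    show "s t ?p1 + s (t\<^sup>2) ?p2 + s (t ^ 3) 0 = 0" for t
      using expand[of t] unfolding \<open>?p0 = 0\<close>
      by (simp only: add_0_left add_0_right scale_zero_right)
  qed
qed

lemma equivalence_linear_coefficient:
  fixes s :: "'k::field_char_0 \<Rightarrow> 'w::ab_group_add \<Rightarrow> 'w"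
  assumes m: "bilinear_on s s s m" and n: "bilinear_on s s s n"
    and P: "Vector_Spaces.linear s s P"
    and hom: "\<And>t. m a b + s t (n' a b) + s t (P (m a b + s t (n' a b)))
      = m (a + s t (P a)) (b + s t (P b)) + s t (n (a + s t (P a)) (b + s t (P b)))"
  shows "n' a b - n a b = m (P a) b + m a (P b) - P (m a b)"
proof -
  interpret vector_space s
    using m by (rule bilinear_on_vector_space)
  interpret P: Vector_Spaces.linear s s P by fact
  have "n' a b - n a b - (m (P a) b + m a (P b) - P (m a b)) = 0"
  proof (rule linear_coefficient_eq_0[OF vector_space_axioms])
    fix t
    \<comment> \<open>The constant terms \<open>m a b\<close> cancel. The cubic term arises because
      \<open>n\<close>, already of order t, is applied to two arguments that each carry a term of
      order t.\<close>
    show "s t (n' a b - n a b - (m (P a) b + m a (P b) - P (m a b)))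
      + s (t\<^sup>2) (P (n' a b) - m (P a) (P b) - n (P a) b - n a (P b))
      + s (t ^ 3) (- n (P a) (P b)) = 0"
      using hom[of t]
      by (simp add: bilinear_on_simps[OF m] bilinear_on_simps[OF n] P.add P.scale
          algebra_simps power2_eq_square power3_eq_cube)
  qed
  then show ?thesis by simp
qed

lemma equivalence_derivation_linear_coefficient:
  fixes s :: "'k::field_char_0 \<Rightarrow> 'w::ab_group_add \<Rightarrow> 'w"
  assumes d: "Vector_Spaces.linear s s d" and e: "Vector_Spaces.linear s s e"
    and P: "Vector_Spaces.linear s s P"
    and hom: "\<And>t. d a + s t (e' a) + s t (P (d a + s t (e' a)))
      = d (a + s t (P a)) + s t (e (a + s t (P a)))"
  shows "e' a - e a = d (P a) - P (d a)"
proof -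
  interpret vector_space s
    using d by (simp add: Vector_Spaces.linear_iff)
  interpret d: Vector_Spaces.linear s s d by fact
  interpret e: Vector_Spaces.linear s s e by fact
  interpret P: Vector_Spaces.linear s s P by fact
  have "e' a - e a - (d (P a) - P (d a)) = 0"
  proof (rule linear_coefficient_eq_0[OF vector_space_axioms])
    fix t
    show "s t (e' a - e a - (d (P a) - P (d a))) + s (t\<^sup>2) (P (e' a) - e (P a)) + s (t ^ 3) 0 = 0"
      using hom[of t]
      by (simp add: P.add P.scale d.add d.scale e.add e.scale algebra_simps power2_eq_square)
  qed
  then show ?thesis by simp
qed

section \<open>Cochains\<close>

lemma unary_in_Hom_wedge:
  "Vector_Spaces.linear sb sc f \<Longrightarrow> unary f \<in> Hom_wedge sa sb sc 0"
  by (auto simp: Hom_wedge_def unary_def split: list.split)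

lemma binary_in_Hom_wedge:
  "bilinear_on sa sb sc f \<Longrightarrow> binary f \<in> Hom_wedge sa sb sc 1"
  by (auto simp: Hom_wedge_def binary_def bilinear_on_def length_Suc_conv split: list.split)

lemma binary_V_in_Hom_wedge2:
  assumes "bilinear_on sb sd sc f"
  shows "binary_V f \<in> Hom_wedge2 sa sb sd sc 0"
proof -
  interpret vector_space_pair sb sc
    using assms by (intro vector_space_pair.intro bilinear_on_vector_space)
  show ?thesis
    using assms bilinear_on_vector_space[OF assms]
    by (auto simp: Hom_wedge2_def Hom_wedge_def binary_V_def bilinear_on_def
        Vector_Spaces.linear_iff split: list.split)
qed

lemma cochain_of_deformation_eq:
  assumes "vector_space sv"
  shows "cochain_of_deformation sv \<omega> \<sigma> \<tau> Dh
    = (binary (semidirect \<omega> \<sigma> (\<lambda>x v. \<tau> v x)), unary (horizontal Dh))"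
  using assms by (simp add: cochain_of_deformation_def semidirect_lift horizontal_lift)

lemma cochain_of_deformation_in_cochains:
  assumes "bilinear_on sg sg sg \<omega>" "bilinear_on sg sv sv \<sigma>" "bilinear_on sv sg sv \<tau>"
    and "Vector_Spaces.linear sg sv Dh"
  shows "cochain_of_deformation sv \<omega> \<sigma> \<tau> Dh \<in> cochains sg sv 2"
proof -
  \<comment> \<open>The differences 2 - 1 and 2 - 2 mirror the degrees in \<open>cochains\<close> at
    n = 2.\<close>
  have "binary \<omega> \<in> Hom_wedge sg sg sg (2 - 1)" "binary \<sigma> \<in> Hom_wedge sg sv sv (2 - 1)"
    "binary_V \<tau> \<in> Hom_wedge2 sg sv sg sv (2 - 2)" "unary Dh \<in> Hom_wedge sg sg sv (2 - 2)"
    using assms binary_in_Hom_wedge binary_V_in_Hom_wedge2 unary_in_Hom_wedge by simp_all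
  then show ?thesis
    unfolding cochain_of_deformation_def cochains_def by auto
qed

lemma map_prod_in_cochains:
  assumes "Vector_Spaces.linear sg sg N" "Vector_Spaces.linear sv sv S"
  shows "(unary (map_prod N S), 0) \<in> cochains sg sv 1"
  unfolding map_prod_lift[symmetric] cochains_def
  using unary_in_Hom_wedge[OF assms(1)] unary_in_Hom_wedge[OF assms(2)] by auto

section \<open>Explicit coboundaries in degrees 1 and 2\<close>

context pre_lie_representation
begin

text \<open>The sign is (-1) to the power -1, that is -1: it cancels the minus in the first
  component and reverses the commutator in the second.\<close>

lemma coboundary_1:
  fixes D :: "'g \<Rightarrow> 'v"
  defines "m \<equiv> semidirect prd \<rho> \<mu>"
  shows "coboundary sg sv prd D \<rho> \<mu> 1 (unary P, 0)
    = (binary (\<lambda>a b. m (P a) b + m a (P b) - P (m a b)),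
       unary (\<lambda>a. horizontal D (P a) - P (horizontal D a)))"
proof -
  interpret vector_space_prod sg sv ..
  have m: "bilinear_on scale scale scale m"
    unfolding m_def by (intro bilinear_on_semidirect prd_bilinear rho_bilinear mu_bilinear)
  \<comment> \<open>Written as a unary map, the component \<theta> = 0 falls under
    \<open>MN_bracket_binary_unary\<close>; the index n - 2 truncates to 0.\<close>
  have 0: "(0 :: ('g \<times> 'v) list \<Rightarrow> 'g \<times> 'v \<Rightarrow> 'g \<times> 'v) = unary (\<lambda>_. 0)"
    by (intro ext) (simp add: unary_def split: list.split)
  have "coboundary sg sv prd D \<rho> \<mu> 1 (unary P, 0)
    = (\<lambda>ws w. scale (- 1) (- binary (\<lambda>a b. m (P a) b + m a (P b) - P (m a b)) ws w),
       \<lambda>ws w. scale (- 1) (binary (\<lambda>a b. 0) ws w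
         + unary (\<lambda>a. P (horizontal D a) - horizontal D (P a)) ws w))"
    by (simp add: coboundary_def Let_def semidirect_lift[OF V.vector_space_axioms] horizontal_lift 0
        m_def[symmetric] p.MN_bracket_binary_unary p.MN_bracket_unary_unary bilinear_on_simps[OF m]
        power_int_minus)
  also have "\<dots> = (binary (\<lambda>a b. m (P a) b + m a (P b) - P (m a b)),
       unary (\<lambda>a. horizontal D (P a) - P (horizontal D a)))"
    by (intro arg_cong2[where f = Pair] ext) (simp_all add: binary_def unary_def split: list.split)
  finally show ?thesis .
qed

text \<open>Here the sign is +1, so the minus in the first component survives, and both brackets in
  the second are of the form binary with unary.\<close>

lemma coboundary_2:
  fixes D :: "'g \<Rightarrow> 'v"
  defines "m \<equiv> semidirect prd \<rho> \<mu>"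
  shows "coboundary sg sv prd D \<rho> \<mu> 2 (binary n, unary e)
    = (\<lambda>xs c. case xs of [a, b] \<Rightarrow>
         - (m (n a b) c - m (n b a) c - m a (n b c) + m b (n a c)
            + n (m a b) c - n (m b a) c - n a (m b c) + n b (m a c)) | _ \<Rightarrow> 0,
       binary (\<lambda>a b. m (e a) b + m a (e b) - e (m a b)
         + (n (horizontal D a) b + n a (horizontal D b) - horizontal D (n a b))))"
proof -
  interpret vector_space_prod sg sv ..
  show ?thesis
    by (simp add: coboundary_def Let_def semidirect_lift[OF V.vector_space_axioms] horizontal_lift
        m_def[symmetric] p.MN_bracket_binary_unary p.MN_bracket_binary_binary)
      (intro conjI ext; simp add: binary_def split: list.split)
qed

end

section \<open>Transport of deformations and homomorphisms to the semidirect product\<close>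

lemma semidirect_add:
  "semidirect (\<lambda>x y. p x y + sg t (\<omega> x y)) (\<lambda>x v. r x v + sv t (\<sigma> x v)) (\<lambda>x v. m x v + sv t (\<tau> v x))
    = (\<lambda>a b. semidirect p r m a b + module_prod.scale sg sv t (semidirect \<omega> \<sigma> (\<lambda>x v. \<tau> v x) a b))"
  if "vector_space sg" "vector_space sv"
proof -
  interpret vector_space_prod sg sv
    using that by (intro vector_space_prod.intro vector_space_pair.intro)
  show ?thesis
    by (auto simp: semidirect_def scale_def fun_eq_iff algebra_simps)
qed

lemma horizontal_add:
  "horizontal (\<lambda>x. d x + sv t (e x))
    = (\<lambda>a. horizontal d a + module_prod.scale sg sv t (horizontal e a))"
  if "vector_space sg" "vector_space sv"
proof -
  interpret vector_space_prod sg sv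
    using that by (intro vector_space_prod.intro vector_space_pair.intro)
  show ?thesis
    by (auto simp: horizontal_def scale_def fun_eq_iff)
qed

lemma map_prod_add:
  "map_prod (\<lambda>x. x + sg t (N x)) (\<lambda>v. v + sv t (S v))
    = (\<lambda>a. a + module_prod.scale sg sv t (map_prod N S a))"
  if "vector_space sg" "vector_space sv"
proof -
  interpret vector_space_prod sg sv
    using that by (intro vector_space_prod.intro vector_space_pair.intro)
  show ?thesis
    by (auto simp: scale_def fun_eq_iff)
qed

text \<open>Additivity of \<psi> combines the equations for \<rho> and \<mu> into the V component of
  the product; in the second claim, the zero algebra component is preserved because \<phi> is
  linear.\<close>

lemma pre_LieDer_hom_semidirect:
  assumes "pre_LieDer_hom sg sv (p', d', r', m') (p, d, r, m) \<phi> \<psi>"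
  shows "map_prod \<phi> \<psi> (semidirect p' r' m' a b)
      = semidirect p r m (map_prod \<phi> \<psi> a) (map_prod \<phi> \<psi> b)"
    and "map_prod \<phi> \<psi> (horizontal d' a) = horizontal d (map_prod \<phi> \<psi> a)"
proof -
  interpret \<phi>: Vector_Spaces.linear sg sg \<phi>
    using assms by (simp add: pre_LieDer_hom_def)
  interpret \<psi>: Vector_Spaces.linear sv sv \<psi>
    using assms by (simp add: pre_LieDer_hom_def)
  show "map_prod \<phi> \<psi> (semidirect p' r' m' a b)
      = semidirect p r m (map_prod \<phi> \<psi> a) (map_prod \<phi> \<psi> b)"
    and "map_prod \<phi> \<psi> (horizontal d' a) = horizontal d (map_prod \<phi> \<psi> a)"
    using assms by (simp_all add: pre_LieDer_hom_def semidirect_def horizontal_def \<psi>.add \<phi>.zero)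
qed

section \<open>Deformations as cocycles and equivalences as coboundaries\<close>

lemma coboundary_1_in_coboundaries:
  assumes "Vector_Spaces.linear sg sg N" "Vector_Spaces.linear sv sv S"
  shows "coboundary sg sv prd D \<rho> \<mu> 1 (unary (map_prod N S), 0) \<in> coboundaries sg sv prd D \<rho> \<mu> 2"
  using map_prod_in_cochains[OF assms] by (simp add: coboundaries_def)

text \<open>The two t-coefficients that vanish are, up to sign, the two components computed in
  \<open>coboundary_2\<close>.\<close>

lemma infinitesimal_deformation_cocycle:
  fixes sg :: "'k::field_char_0 \<Rightarrow> 'g::ab_group_add \<Rightarrow> 'g"
    and sv :: "'k \<Rightarrow> 'v::ab_group_add \<Rightarrow> 'v"
  assumes "pre_LieDer_pair sg sv prd D \<rho> \<mu>"
    and deformation: "infinitesimal_deformation sg sv prd D \<rho> \<mu> \<omega> \<sigma> \<tau> Dh"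
  shows "cochain_of_deformation sv \<omega> \<sigma> \<tau> Dh \<in> cocycles sg sv prd D \<rho> \<mu> 2"
proof -
  interpret pre_LieDer_pair sg sv prd D \<rho> \<mu> by fact
  interpret vector_space_prod sg sv ..
  have lin: "bilinear_on sg sg sg \<omega>" "bilinear_on sg sv sv \<sigma>" "bilinear_on sv sg sv \<tau>"
    "Vector_Spaces.linear sg sv Dh"
    and pair: "\<And>t. pre_LieDer_pair sg sv (\<lambda>x y. prd x y + sg t (\<omega> x y)) (\<lambda>x. D x + sv t (Dh x))
      (\<lambda>x v. \<rho> x v + sv t (\<sigma> x v)) (\<lambda>x v. \<mu> x v + sv t (\<tau> v x))"
    using deformation by (auto simp: infinitesimal_deformation_def deform_def)
  define m where "m = semidirect prd \<rho> \<mu>"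
  define n where "n = semidirect \<omega> \<sigma> (\<lambda>x v. \<tau> v x)"
  have m: "bilinear_on scale scale scale m"
    unfolding m_def by (intro bilinear_on_semidirect prd_bilinear rho_bilinear mu_bilinear)
  \<comment> \<open>The unfolding of \<open>bilinear_on\<close> serves to swap the arguments of
    \<tau>, which takes the vector first.\<close>
  have n: "bilinear_on scale scale scale n"
    unfolding n_def using lin by (intro bilinear_on_semidirect) (auto simp: bilinear_on_def)
  note add = semidirect_add[OF vector_space_axioms V.vector_space_axioms, of prd _ \<omega> \<rho> \<sigma> \<mu> \<tau>,
      folded m_def n_def]
    horizontal_add[OF vector_space_axioms V.vector_space_axioms, of D _ Dh]
  have product: "m (n a b) c - m (n b a) c - m a (n b c) + m b (n a c)
    + n (m a b) c - n (m b a) c - n a (m b c) + n b (m a c) = 0" for a b c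
  proof (rule pre_lie_deformation_linear_coefficient[OF m n])
    show "pre_lie_algebra scale (\<lambda>a b. m a b + scale t (n a b))" for t
      using pre_lie_representation.pre_lie_algebra_semidirect[OF pre_LieDer_pair.axioms(1), OF pair]
      unfolding add .
  qed
  have derivation: "m (horizontal Dh a) b + m a (horizontal Dh b) - horizontal Dh (m a b)
    + (n (horizontal D a) b + n a (horizontal D b) - horizontal D (n a b)) = 0" for a b
  proof (rule derivation_deformation_linear_coefficient[OF m n])
    fix t a b
    show "horizontal D (m a b + scale t (n a b)) + scale t (horizontal Dh (m a b + scale t (n a b)))
      = m (horizontal D a + scale t (horizontal Dh a)) b
        + scale t (n (horizontal D a + scale t (horizontal Dh a)) b)
        + (m a (horizontal D b + scale t (horizontal Dh b))
          + scale t (n a (horizontal D b + scale t (horizontal Dh b))))"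
      using pre_LieDer_pair.horizontal_derivation[OF pair, of t a b] unfolding add .
  qed (use lin D_linear linear_horizontal in auto)
  have "coboundary sg sv prd D \<rho> \<mu> 2 (binary n, unary (horizontal Dh)) = 0"
    unfolding coboundary_2 m_def[symmetric] product derivation
    by (simp add: binary_def fun_eq_iff zero_prod_def split: list.split)
  then show ?thesis
    using cochain_of_deformation_in_cochains[OF lin]
    by (simp add: cocycles_def cochain_of_deformation_eq[OF V.vector_space_axioms] n_def)
qed

text \<open>The 1-cochain bounding the difference is \<open>map_prod N S\<close>, with
  \<open>N\<close> and \<open>S\<close> from the equivalence; the t-coefficients of the homomorphism
  equations agree with \<open>coboundary_1\<close>, signs included.\<close>

lemma equivalent_deformations_coboundary:
  fixes sg :: "'k::field_char_0 \<Rightarrow> 'g::ab_group_add \<Rightarrow> 'g"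
    and sv :: "'k \<Rightarrow> 'v::ab_group_add \<Rightarrow> 'v"
  assumes "pre_LieDer_pair sg sv prd D \<rho> \<mu>"
    and deformation: "infinitesimal_deformation sg sv prd D \<rho> \<mu> \<omega> \<sigma> \<tau> Dh"
    and equivalent: "equivalent_deformations sg sv
      (deform sg sv prd D \<rho> \<mu> \<omega>' \<sigma>' \<tau>' Dh') (deform sg sv prd D \<rho> \<mu> \<omega> \<sigma> \<tau> Dh)"
  shows "cochain_of_deformation sv \<omega>' \<sigma>' \<tau>' Dh' - cochain_of_deformation sv \<omega> \<sigma> \<tau> Dh
    \<in> coboundaries sg sv prd D \<rho> \<mu> 2"
proof -
  interpret pre_LieDer_pair sg sv prd D \<rho> \<mu> by fact
  interpret vector_space_prod sg sv ..
  have lin: "bilinear_on sg sg sg \<omega>" "bilinear_on sg sv sv \<sigma>" "bilinear_on sv sg sv \<tau>"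
    "Vector_Spaces.linear sg sv Dh"
    using deformation by (auto simp: infinitesimal_deformation_def)
  obtain N S where NS: "Vector_Spaces.linear sg sg N" "Vector_Spaces.linear sv sv S"
    and hom: "\<And>t. pre_LieDer_hom sg sv (deform sg sv prd D \<rho> \<mu> \<omega>' \<sigma>' \<tau>' Dh' t)
      (deform sg sv prd D \<rho> \<mu> \<omega> \<sigma> \<tau> Dh t) (\<lambda>x. x + sg t (N x)) (\<lambda>v. v + sv t (S v))"
    using equivalent by (auto simp: equivalent_deformations_def)
  define P where "P = map_prod N S"
  define m where "m = semidirect prd \<rho> \<mu>"
  define n where "n = semidirect \<omega> \<sigma> (\<lambda>x v. \<tau> v x)"
  define n' where "n' = semidirect \<omega>' \<sigma>' (\<lambda>x v. \<tau>' v x)"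
  have P: "Vector_Spaces.linear scale scale P"
    unfolding P_def using NS by (rule linear_map_prod)
  have m: "bilinear_on scale scale scale m"
    unfolding m_def by (intro bilinear_on_semidirect prd_bilinear rho_bilinear mu_bilinear)
  have n: "bilinear_on scale scale scale n"
    unfolding n_def using lin by (intro bilinear_on_semidirect) (auto simp: bilinear_on_def)
  note add = semidirect_add[OF vector_space_axioms V.vector_space_axioms]
    horizontal_add[OF vector_space_axioms V.vector_space_axioms]
    map_prod_add[OF vector_space_axioms V.vector_space_axioms]
  \<comment> \<open>On the direct sum the four homomorphism equations become two:
    \<open>Id + t P\<close> intertwines the deformed products and the deformed derivations.\<close>
  note hom_W = pre_LieDer_hom_semidirect[OF hom[unfolded deform_def], unfolded add,
      folded P_def m_def n_def n'_def]
  have product: "n' a b - n a b = m (P a) b + m a (P b) - P (m a b)" for a b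
  proof (rule equivalence_linear_coefficient[OF m n P])
    show "m a b + scale t (n' a b) + scale t (P (m a b + scale t (n' a b)))
      = m (a + scale t (P a)) (b + scale t (P b))
        + scale t (n (a + scale t (P a)) (b + scale t (P b)))" for t
      by (rule hom_W)
  qed
  have derivation: "horizontal Dh' a - horizontal Dh a = horizontal D (P a) - P (horizontal D a)" for a
  proof (rule equivalence_derivation_linear_coefficient[OF _ _ P])
    show "horizontal D a + scale t (horizontal Dh' a)
        + scale t (P (horizontal D a + scale t (horizontal Dh' a)))
      = horizontal D (a + scale t (P a)) + scale t (horizontal Dh (a + scale t (P a)))" for t
      by (rule hom_W)
  qed (use lin D_linear linear_horizontal in auto)
  have "(binary n', unary (horizontal Dh')) - (binary n, unary (horizontal Dh))
    = (binary (\<lambda>a b. n' a b - n a b), unary (\<lambda>a. horizontal Dh' a - horizontal Dh a))"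
    by (simp add: binary_def unary_def fun_eq_iff split: list.split)
  also have "\<dots> = coboundary sg sv prd D \<rho> \<mu> 1 (unary P, 0)"
    unfolding coboundary_1 m_def[symmetric] product derivation ..
  also have "\<dots> \<in> coboundaries sg sv prd D \<rho> \<mu> 2"
    unfolding P_def using NS by (rule coboundary_1_in_coboundaries)
  finally show ?thesis
    by (simp only: cochain_of_deformation_eq[OF V.vector_space_axioms] n_def n'_def)
qed

text \<open>This gives reflexivity of the cohomology relation on cocycles. The zero 1-cochain, with
  \<open>N\<close> and \<open>S\<close> both zero, is the witness.\<close>

lemma (in pre_LieDer_pair) zero_in_coboundaries: "0 \<in> coboundaries sg sv prd D \<rho> \<mu> 2"
proof -
  interpret vector_space_prod sg sv ..
  have m: "bilinear_on scale scale scale (semidirect prd \<rho> \<mu>)"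
    by (intro bilinear_on_semidirect prd_bilinear rho_bilinear mu_bilinear)
  have zero: "map_prod (\<lambda>_. 0) (\<lambda>_. 0) = (\<lambda>_ :: 'g \<times> 'v. 0 :: 'g \<times> 'v)"
    by (auto simp: fun_eq_iff zero_prod_def)
  have "D 0 = 0"
    using D_linear by (rule linear_0)
  then have "horizontal D 0 = 0"
    by (simp add: horizontal_def zero_prod_def)
  then have "coboundary sg sv prd D \<rho> \<mu> 1 (unary (map_prod (\<lambda>_. 0) (\<lambda>_. 0)), 0) = 0"
    unfolding coboundary_1 zero
    by (intro prod_eqI ext)
      (simp_all add: bilinear_on_simps[OF m] binary_def unary_def split: list.split)
  moreover have "Vector_Spaces.linear sg sg (\<lambda>_. 0)" "Vector_Spaces.linear sv sv (\<lambda>_. 0)"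
    by (simp_all add: Vector_Spaces.linear_iff vector_space_axioms V.vector_space_axioms)
  ultimately show ?thesis
    using coboundary_1_in_coboundaries[of sg "\<lambda>_. 0" sv "\<lambda>_. 0"] by metis
qed

theorem theorem4p8:
  fixes sg :: "'k::{alg_closed_field, field_char_0} \<Rightarrow> 'g::ab_group_add \<Rightarrow> 'g"
    and sv :: "'k \<Rightarrow> 'v::ab_group_add \<Rightarrow> 'v"
    and prd \<omega> \<omega>' :: "'g \<Rightarrow> 'g \<Rightarrow> 'g"
    and \<rho> \<mu> \<sigma> \<sigma>' :: "'g \<Rightarrow> 'v \<Rightarrow> 'v"
    and \<tau> \<tau>' :: "'v \<Rightarrow> 'g \<Rightarrow> 'v"
    and D Dh Dh' :: "'g \<Rightarrow> 'v"
  assumes "pre_LieDer_pair sg sv prd D \<rho> \<mu>"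
    and "infinitesimal_deformation sg sv prd D \<rho> \<mu> \<omega>' \<sigma>' \<tau>' Dh'"
    and "infinitesimal_deformation sg sv prd D \<rho> \<mu> \<omega> \<sigma> \<tau> Dh"
    and "equivalent_deformations sg sv
           (deform sg sv prd D \<rho> \<mu> \<omega>' \<sigma>' \<tau>' Dh') (deform sg sv prd D \<rho> \<mu> \<omega> \<sigma> \<tau> Dh)"
  shows "\<exists>c \<in> cohomology sg sv prd D \<rho> \<mu> 2.
           cochain_of_deformation sv \<omega>' \<sigma>' \<tau>' Dh' \<in> c \<and>
           cochain_of_deformation sv \<omega> \<sigma> \<tau> Dh \<in> c"
proof -
  interpret pre_LieDer_pair sg sv prd D \<rho> \<mu> by fact
  let ?a = "cochain_of_deformation sv \<omega>' \<sigma>' \<tau>' Dh'" and ?b = "cochain_of_deformation sv \<omega> \<sigma> \<tau> Dh"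
  let ?R = "{(a, b). a \<in> cocycles sg sv prd D \<rho> \<mu> 2 \<and> b \<in> cocycles sg sv prd D \<rho> \<mu> 2 \<and>
    a - b \<in> coboundaries sg sv prd D \<rho> \<mu> 2}"
  have "?a \<in> cocycles sg sv prd D \<rho> \<mu> 2" "?b \<in> cocycles sg sv prd D \<rho> \<mu> 2"
    using infinitesimal_deformation_cocycle assms by blast+
  moreover have "?a - ?b \<in> coboundaries sg sv prd D \<rho> \<mu> 2"
    using equivalent_deformations_coboundary assms by blast
  \<comment> \<open>The common class is the image of \<open>?a\<close> under the relation:
    \<open>?a\<close> lies in it because 0 is a coboundary, \<open>?b\<close> because
    \<open>?a - ?b\<close> is one.\<close>
  ultimately have "?R `` {?a} \<in> cohomology sg sv prd D \<rho> \<mu> 2"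
    and "?a \<in> ?R `` {?a} \<and> ?b \<in> ?R `` {?a}"
    using zero_in_coboundaries quotientI[of ?a "cocycles sg sv prd D \<rho> \<mu> 2" ?R]
    by (simp_all add: cohomology_def)
  then show ?thesis
    by (rule bexI[rotated])
qed

end
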